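(* Let $\mathbb{A}\colon\mathbb{R}^n\rightrightarrows\mathbb{R}^n$ be maximal monotone and uniformly monotone with parameters $\mu>0$ and $\alpha>1$, let $x_\star\in\mathrm{Zer}\,\mathbb{A}$, let $x_0\in\mathbb{R}^n$ be an initial point, and let $N$ be the total number of iterations. Define \[ \lambda=\left(\frac{e}{\mu}\right)^{\frac1\alpha}\|x_0-x_\star\|^{-\left(1-\frac1\alpha\right)},\qquad \beta=1-\frac1\alpha. \] Let $R\in\mathbb{N}$ be an integer satisfying \[ \sum_{k=1}^{R}\lceil\lambda e^{\beta k}\rceil\le N-1<\sum_{k=1}^{R+1}\lceil\lambda e^{\beta k}\rceil, \] and let $t_k$ be defined as \[ t_k=\begin{cases}\lceil\lambda e^{\beta k}\rceil & \text{for } k=1,\dots,R-1,\\ N-1-\sum_{j=1}^{R-1}t_j & \text{for } k=R.\end{cases} \] Consider the restarted method \[ \tilde{x}_0=\mathbb{J}_{\mathbb{A}}x_0,\qquad \tilde{x}_k\leftarrow\textbf{OS-PPM}_0(\tilde{x}_{k-1},t_k),\quad k=1,\dots,R, \] let $x_N=\tilde{x}_R$ be its final output (after $N$ iterations in total), and let $\tilde{\mathbb{A}}x_N$ be the resolvent residual at its last step. Then \[ \|\tilde{\mathbb{A}}x_N\|^2\le\left\{\frac{e^\beta-1}{\lambda e^{2\beta}}\left(N-2-\frac1\beta\log\left(\frac{e^\beta-1}{\lambda e^\beta}(N-1)+1\right)\right)+\frac{1}{e^\beta}\right\}^{-\frac{2\alpha}{\alpha-1}}\|x_0-x_\star\|^2=\mathcal{O}\left(N^{-\frac{2\alpha}{\alpha-1}}\right).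 \]
   Context: $\mathbb{R}^n$ carries the standard inner product and norm; $\mathbb{N}=\{1,2,\dots\}$. A set-valued operator $\mathbb{A}$ is monotone if $\langle u-v,x-y\rangle\ge 0$ for all $u\in\mathbb{A}x$, $v\in\mathbb{A}y$, and maximal monotone if its graph is not properly contained in that of another monotone operator. $\mathbb{A}$ is uniformly monotone with parameters $\mu>0$, $\alpha>1$ if it is monotone and $\langle u,x-x_\star\rangle\ge\mu\|x-x_\star\|^{\alpha+1}$ for all $x\in\mathbb{R}^n$, $u\in\mathbb{A}x$ and $x_\star\in\mathrm{Zer}\,\mathbb{A}=\{x:0\in\mathbb{A}x\}$. $\mathbb{J}_{\mathbb{A}}=(\mathbb{I}+\mathbb{A})^{-1}$ is the resolvent (single-valued with full domain), where $\mathbb{I}$ is the identity. $\textbf{OS-PPM}_0(z,t)$ denotes the point $x_t$ obtained by running $t$ iterations of the following method from $x_0'=y_0=y_{-1}=z$ (with $x_0'$ in the role of $x_0$ below), with $\varphi_k=k+1$ for $k\ge -1$: for $k=1,\dots,t$, \[ x_k=\mathbb{J}_{\mathbb{A}}y_{k-1},\qquad y_k=x_k+\frac{\varphi_{k-1}-1}{\varphi_k}(x_k-x_{k-1})+\frac{\varphi_{k-2}}{\varphi_k}(y_{k-2}-x_{k-1}). \] The resolvent residual at its output $x_t$ is $y_{t-1}-x_t\in\mathbb{A}x_t$; $\tilde{\mathbb{A}}x_N$ in the claim is this residual for the last call $\textbf{OS-PPM}_0(\tilde{x}_{R-1},t_R)$. The $\mathcal{O}$ is as $N\to\infty$.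
   Formalization: The explicit inequality is asserted only when the expression in braces is positive; for small N it can be negative, where the power is undefined or the claim fails (e.g. Ax = x|x| on R, N = 2, x_0 large). The O-claims are unrestricted. *)

theory Defs
  imports "HOL-Analysis.Analysis" "HOL-Library.Landau_Symbols"
begin

type_synonym 'n operator = "real ^ 'n \<Rightarrow> (real ^ 'n) set"

definition op_graph :: "'n::finite operator \<Rightarrow> ((real ^ 'n) \<times> (real ^ 'n)) set" where
  "op_graph A = {(x, u). u \<in> A x}"

definition monotone_operator :: "'n::finite operator \<Rightarrow> bool" where
  "monotone_operator A \<longleftrightarrow>
     (\<forall>x y. \<forall>u\<in>A x. \<forall>v\<in>A y. 0 \<le> (u - v) \<bullet> (x - y))"

definition maximal_monotone :: "'n::finite operator \<Rightarrow> bool" where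
  "maximal_monotone A \<longleftrightarrow>
     monotone_operator A \<and> (\<nexists>B. monotone_operator B \<and> op_graph A \<subset> op_graph B)"

definition Zer :: "'n::finite operator \<Rightarrow> (real ^ 'n) set" where
  "Zer A = {x. 0 \<in> A x}"

definition uniformly_monotone :: "real \<Rightarrow> real \<Rightarrow> 'n::finite operator \<Rightarrow> bool" where
  "uniformly_monotone \<mu> \<alpha> A \<longleftrightarrow>
     monotone_operator A \<and>
     (\<forall>x. \<forall>u\<in>A x. \<forall>xs\<in>Zer A. \<mu> * norm (x - xs) powr (\<alpha> + 1) \<le> u \<bullet> (x - xs))"

(* The value of (I + A)^{-1} at y; for maximal monotone A there is exactly one
   x with y in (I + A) x (Minty). *)
definition resolvent :: "'n::finite operator \<Rightarrow> real ^ 'n \<Rightarrow> real ^ 'n" where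
  "resolvent A y = (THE x. y \<in> {x + u | u. u \<in> A x})"

definition phi :: "int \<Rightarrow> real" where
  "phi k = real_of_int k + 1"

(* The state after k iterations is (x_k, y_k, y_{k-1}), with y_{-1} = z at k = 0. *)
fun os_ppm0_state ::
  "'n::finite operator \<Rightarrow> real ^ 'n \<Rightarrow> nat \<Rightarrow> (real ^ 'n) \<times> (real ^ 'n) \<times> (real ^ 'n)" where
  "os_ppm0_state A z 0 = (z, z, z)"
| "os_ppm0_state A z (Suc j) =
     (let k = int (Suc j);
          (x_prev, y_prev, y_prev2) = os_ppm0_state A z j;
          x = resolvent A y_prev;
          y = x + ((phi (k - 1) - 1) / phi k) *\<^sub>R (x - x_prev)
                + (phi (k - 2) / phi k) *\<^sub>R (y_prev2 - x_prev)
      in (x, y, y_prev))"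

definition os_ppm0 :: "'n::finite operator \<Rightarrow> real ^ 'n \<Rightarrow> nat \<Rightarrow> real ^ 'n" where
  "os_ppm0 A z t = (case os_ppm0_state A z t of (x, y, y_prev) \<Rightarrow> x)"

(* The residual y_{t-1} - x_t, meaningful for t \<ge> 1. *)
definition os_ppm0_residual :: "'n::finite operator \<Rightarrow> real ^ 'n \<Rightarrow> nat \<Rightarrow> real ^ 'n" where
  "os_ppm0_residual A z t = (case os_ppm0_state A z t of (x, y, y_prev) \<Rightarrow> y_prev - x)"

definition restart_count :: "real \<Rightarrow> real \<Rightarrow> nat \<Rightarrow> nat \<Rightarrow> bool" where
  "restart_count lam \<beta> N R \<longleftrightarrow>
     1 \<le> R \<and>
     (\<Sum>k=1..R. \<lceil>lam * exp (\<beta> * real k)\<rceil>) \<le> int N - 1 \<and>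
     int N - 1 < (\<Sum>k=1..R+1. \<lceil>lam * exp (\<beta> * real k)\<rceil>)"

(* The lengths t_k of the inner runs, for 1 \<le> k \<le> R. Under restart_count the
   integers converted here are nonnegative. *)
definition restart_length :: "real \<Rightarrow> real \<Rightarrow> nat \<Rightarrow> nat \<Rightarrow> nat \<Rightarrow> nat" where
  "restart_length lam \<beta> N R k =
     nat (if k < R then \<lceil>lam * exp (\<beta> * real k)\<rceil>
          else int N - 1 - (\<Sum>j=1..<R. \<lceil>lam * exp (\<beta> * real j)\<rceil>))"

primrec restarted ::
  "'n::finite operator \<Rightarrow> real ^ 'n \<Rightarrow> (nat \<Rightarrow> nat) \<Rightarrow> nat \<Rightarrow> real ^ 'n" where
  "restarted A x0 t 0 = resolvent A x0"
| "restarted A x0 t (Suc k) = os_ppm0 A (restarted A x0 t k) (t (Suc k))"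

(* The residual at restarted A x0 t R, i.e. that of its last inner run (R \<ge> 1). *)
definition restarted_residual ::
  "'n::finite operator \<Rightarrow> real ^ 'n \<Rightarrow> (nat \<Rightarrow> nat) \<Rightarrow> nat \<Rightarrow> real ^ 'n" where
  "restarted_residual A x0 t R = os_ppm0_residual A (restarted A x0 t (R - 1)) (t R)"

definition rate_base :: "real \<Rightarrow> real \<Rightarrow> nat \<Rightarrow> real" where
  "rate_base lam \<beta> N =
     (exp \<beta> - 1) / (lam * exp (2 * \<beta>)) *
       (real N - 2 - 1 / \<beta> * ln ((exp \<beta> - 1) / (lam * exp \<beta>) * (real N - 1) + 1))
     + 1 / exp \<beta>"

end

theory Submission
  imports Defs "HOL-Real_Asymp.Real_Asymp"
begin

text \<open>
  Along one run, \<open>k\<^sup>2 * norm g\<^sup>2 + k * (g \<bullet> (x - z))\<close> does not increase, where \<open>x\<close> and \<open>g\<close> are the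
  \<open>k\<close>-th iterate and its residual; hence \<open>k * norm g \<le> norm (z - xstar)\<close>. Uniform monotonicity
  bounds the distance of the starting point of a run to \<open>xstar\<close> by the \<open>(1 / \<alpha>)\<close>-th power of its
  residual, so a run of length at least \<open>lam * exp (\<beta> * k)\<close> turns a residual bound \<open>exp (1 - k)\<close> (in
  units of \<open>norm (x0 - xstar)\<close>) into \<open>exp (- k)\<close>. After \<open>R\<close> runs the residual is at most
  \<open>exp (- R)\<close>, and the two bounds on \<open>N\<close> defining \<open>R\<close> give \<open>rate_base lam \<beta> N \<le> exp (\<beta> * R)\<close>.

  The resolvent is total by Minty's theorem: it asks for a common point of the balls
  with diameters from \<open>a\<close> to \<open>y - u\<close>, for \<open>u \<in> A a\<close>, and by compactness only of finitely many.
\<close>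

section \<open>Minty's theorem in finite dimension\<close>

lemma convex_affine_sublevel:
  fixes a b :: "'a::real_inner" and k :: real
  shows "convex {(p, q, s :: real). s + k - p \<bullet> b - a \<bullet> q \<le> 0}"
proof -
  have eq: "{(p, q, s :: real). s + k - p \<bullet> b - a \<bullet> q \<le> 0}
      = {v. (- b, - a, 1) \<bullet> v \<le> - k}"
    by (auto simp: inner_Pair algebra_simps inner_commute)
  show ?thesis
    unfolding eq by (rule convex_halfspace_le)
qed

text \<open>The symmetric bilinear expression below is affine in each argument, so its sign
  extends from the generators to the hull; the diagonal then gives the claim.\<close>
lemma antimonotone_hull_le_inner:
  fixes F :: "('a::real_inner \<times> 'a) set"
  assumes anti: "\<And>a b a' b'. (a, b) \<in> F \<Longrightarrow> (a', b') \<in> F \<Longrightarrow> (a - a') \<bullet> (b - b') \<le> 0"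
    and mem: "(p, q, s) \<in> convex hull ((\<lambda>(a, b). (a, b, a \<bullet> b)) ` F)"
  shows "s \<le> p \<bullet> q"
proof -
  let ?G = "(\<lambda>(a, b). (a, b, a \<bullet> b)) ` F"
  define H where "H a b k = {(p, q, s :: real). s + k - p \<bullet> b - a \<bullet> q \<le> 0}" for a b :: 'a and k
  have convH: "convex (H a b k)" for a b k
    unfolding H_def by (rule convex_affine_sublevel)
  have gen: "?G \<subseteq> H a b (a \<bullet> b)" if "(a, b) \<in> F" for a b
    using anti[OF that] by (auto simp: H_def algebra_simps inner_commute)
  have "(p, q, s) \<in> H a b (a \<bullet> b)" if "(a, b) \<in> F" for a b
    using hull_minimal[of ?G "H a b (a \<bullet> b)" convex] gen[OF that] convH mem by blast
  then have "?G \<subseteq> H p q s"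
    by (force simp: H_def algebra_simps inner_commute)
  then have "(p, q, s) \<in> H p q s"
    using hull_minimal[of ?G "H p q s" convex] convH mem by blast
  then show ?thesis
    by (simp add: H_def)
qed

lemma nonpos_if_le_all_small_mult:
  fixes d e :: real
  assumes "\<And>t. 0 < t \<Longrightarrow> t \<le> 1 \<Longrightarrow> d \<le> t * e"
  shows "d \<le> 0"
proof (rule tendsto_lowerbound)
  show "((\<lambda>t. t * e) \<longlongrightarrow> 0) (at_right 0)"
    by (auto intro!: tendsto_eq_intros)
  show "\<forall>\<^sub>F t in at_right 0. d \<le> t * e"
    unfolding eventually_at_right_field using assms by (intro exI[of _ 1]) auto
qed simp

text \<open>Dual argument: the function \<open>\<lambda>(p, q, s). s - norm ((p + q) / 2)\<^sup>2\<close> is the dual of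
  minimising the maximum of \<open>(x - a) \<bullet> (x - b)\<close> over \<open>x\<close>; first-order optimality at its maximiser
  bounds every single \<open>(x - a) \<bullet> (x - b)\<close> by the dual value, which is nonpositive.\<close>
lemma finite_antimonotone_common_point:
  fixes F :: "('a::euclidean_space \<times> 'a) set"
  assumes fin: "finite F"
    and anti: "\<And>a b a' b'. (a, b) \<in> F \<Longrightarrow> (a', b') \<in> F \<Longrightarrow> (a - a') \<bullet> (b - b') \<le> 0"
  shows "\<exists>x. \<forall>(a, b)\<in>F. (x - a) \<bullet> (x - b) \<le> 0"
proof (cases "F = {}")
  case True
  then show ?thesis by simp
next
  case False
  let ?G = "(\<lambda>(a, b). (a, b, a \<bullet> b)) ` F"
  define K where "K = convex hull ?G"
  define g where "g = (\<lambda>(p :: 'a, q :: 'a, s :: real). s - ((1/2) *\<^sub>R (p + q)) \<bullet> ((1/2) *\<^sub>R (p + q)))"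
  have "compact K" "K \<noteq> {}"
    using fin False by (auto simp: K_def finite_imp_compact_convex_hull)
  moreover have "continuous_on K g"
    unfolding g_def case_prod_unfold by (intro continuous_intros)
  ultimately obtain v where v: "v \<in> K" "\<And>w. w \<in> K \<Longrightarrow> g w \<le> g v"
    using continuous_attains_sup by metis
  obtain p q s where pqs: "v = (p, q, s)" by (cases v)
  define x where "x = (1/2) *\<^sub>R (p + q)"
  have "s \<le> p \<bullet> q"
    using antimonotone_hull_le_inner[OF anti] v(1) unfolding K_def pqs by blast
  also have "p \<bullet> q = x \<bullet> x - ((1/2) *\<^sub>R (p - q)) \<bullet> ((1/2) *\<^sub>R (p - q))"
    by (simp add: x_def algebra_simps inner_commute)
  also have "\<dots> \<le> x \<bullet> x" by simp
  finally have dual: "s - x \<bullet> x \<le> 0" by simp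
  have "(x - a) \<bullet> (x - b) \<le> 0" if ab: "(a, b) \<in> F" for a b
  proof -
    \<comment> \<open>Velocity of the midpoint when \<open>v\<close> moves straight towards the
      generator of \<open>(a, b)\<close>. Its quadratic contribution vanishes as \<open>t\<close>
      tends to 0, leaving the first-order condition.\<close>
    define c where "c = (1/2) *\<^sub>R (a + b) - x"
    have "(a \<bullet> b - s) - 2 * (x \<bullet> c) \<le> t * (c \<bullet> c)" if t: "0 < t" "t \<le> 1" for t
    proof -
      have "(a, b, a \<bullet> b) \<in> K"
        unfolding K_def using ab by (intro hull_inc) force
      then have "(1 - t) *\<^sub>R v + t *\<^sub>R (a, b, a \<bullet> b) \<in> K"
        using v(1) t convex_convex_hull[of ?G] unfolding K_def[symmetric]
        by (intro convexD) auto
      from v(2)[OF this]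
      have le: "((1 - t) * s + t * (a \<bullet> b)) - m \<bullet> m \<le> s - x \<bullet> x"
        if "m = (1/2) *\<^sub>R (((1 - t) *\<^sub>R p + t *\<^sub>R a) + ((1 - t) *\<^sub>R q + t *\<^sub>R b))" for m
        using that by (simp add: g_def pqs x_def)
      have mid: "(1/2) *\<^sub>R (((1 - t) *\<^sub>R p + t *\<^sub>R a) + ((1 - t) *\<^sub>R q + t *\<^sub>R b)) = x + t *\<^sub>R c"
        by (simp add: x_def c_def algebra_simps)
      have "t * ((a \<bullet> b - s) - 2 * (x \<bullet> c)) \<le> t * (t * (c \<bullet> c))"
        using le[OF mid[symmetric]] by (simp add: algebra_simps inner_commute)
      then show ?thesis using t by simp
    qed
    then have "(a \<bullet> b - s) - 2 * (x \<bullet> c) \<le> 0"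
      by (rule nonpos_if_le_all_small_mult)
    moreover have "(x - a) \<bullet> (x - b) = (a \<bullet> b - s) - 2 * (x \<bullet> c) + (s - x \<bullet> x)"
      by (simp add: c_def algebra_simps inner_commute)
    ultimately show ?thesis using dual by simp
  qed
  then show ?thesis by auto
qed

text \<open>Completing the square at the midpoint gives Thales' ball, hence the compactness that the
  finite intersection argument needs.\<close>

lemma inner_diff_le_0_eq_cball:
  fixes a b :: "'a::real_inner"
  shows "{x. (x - a) \<bullet> (x - b) \<le> 0} = cball ((1/2) *\<^sub>R (a + b)) (norm (a - b) / 2)"
proof -
  have "(x - a) \<bullet> (x - b) \<le> 0 \<longleftrightarrow> norm ((1/2) *\<^sub>R (a + b) - x) \<le> norm (a - b) / 2" for x
  proof -
    have "(x - a) \<bullet> (x - b) = (norm ((1/2) *\<^sub>R (a + b) - x))\<^sup>2 - (norm (a - b) / 2)\<^sup>2"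
      unfolding power_divide power2_norm_eq_inner by (simp add: field_simps inner_commute inner_diff inner_add)
    then show ?thesis
      by (simp add: abs_le_square_iff[symmetric])
  qed
  then show ?thesis by (simp only: cball_def dist_norm)
qed

lemma antimonotone_common_point:
  fixes F :: "('a::euclidean_space \<times> 'a) set"
  assumes anti: "\<And>a b a' b'. (a, b) \<in> F \<Longrightarrow> (a', b') \<in> F \<Longrightarrow> (a - a') \<bullet> (b - b') \<le> 0"
  shows "\<exists>x. \<forall>(a, b)\<in>F. (x - a) \<bullet> (x - b) \<le> 0"
proof -
  define C where "C = (\<lambda>(a :: 'a, b). {x. (x - a) \<bullet> (x - b) \<le> 0})"
  have "\<Inter> (C ` F) \<noteq> {}"
  proof (rule compact_fip_Heine_Borel)
    show "compact T" if "T \<in> C ` F" for T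
      using that by (auto simp: C_def inner_diff_le_0_eq_cball)
  next
    fix \<F> assume "finite \<F>" "\<F> \<subseteq> C ` F"
    then obtain F' where F': "F' \<subseteq> F" "finite F'" "\<F> = C ` F'"
      by (meson finite_subset_image)
    then have "\<exists>x. \<forall>(a, b)\<in>F'. (x - a) \<bullet> (x - b) \<le> 0"
      by (intro finite_antimonotone_common_point anti) auto
    then show "\<Inter> \<F> \<noteq> {}"
      unfolding F' C_def by fast
  qed
  then show ?thesis by (fastforce simp: C_def)
qed

text \<open>Otherwise adjoining \<open>(x, v)\<close> to the graph would give a strictly larger
  monotone operator.\<close>

lemma maximal_monotoneD:
  assumes "maximal_monotone A" and "\<And>a w. w \<in> A a \<Longrightarrow> 0 \<le> (v - w) \<bullet> (x - a)"
  shows "v \<in> A x"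
proof (rule ccontr)
  assume nin: "v \<notin> A x"
  define B where "B = A(x := insert v (A x))"
  have mono: "monotone_operator A"
    using assms(1) by (simp add: maximal_monotone_def)
  have sym: "0 \<le> (w - v) \<bullet> (a - x)" if "w \<in> A a" for a w
    using assms(2)[OF that] by (simp add: inner_diff algebra_simps)
  have "monotone_operator B"
    using mono assms(2) sym unfolding monotone_operator_def B_def
    by (auto split: if_splits)
  moreover have "op_graph A \<subset> op_graph B"
    using nin by (auto simp: op_graph_def B_def)
  ultimately show False
    using assms(1) by (auto simp: maximal_monotone_def)
qed

theorem minty:
  fixes A :: "'n::finite operator"
  assumes "maximal_monotone A"
  shows "\<exists>x. y - x \<in> A x"
proof -
  have mono: "0 \<le> (u - v) \<bullet> (a - b)" if "u \<in> A a" "v \<in> A b" for a b u v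
    using assms that by (auto simp: maximal_monotone_def monotone_operator_def)
  \<comment> \<open>For \<open>b = y - u\<close> the inequality reads
    \<open>0 \<le> ((y - x) - u) \<bullet> (x - a)\<close>: the pair \<open>(x, y - x)\<close> is
    monotonically related to the whole graph.\<close>
  have "\<exists>x. \<forall>(a, b)\<in>{(a, y - u) | a u. u \<in> A a}. (x - a) \<bullet> (x - b) \<le> 0"
    by (rule antimonotone_common_point) (use mono in \<open>force simp: algebra_simps inner_commute\<close>)
  then obtain x where x: "(x - a) \<bullet> (x - (y - u)) \<le> 0" if "u \<in> A a" for a u
    by fast
  have "y - x \<in> A x"
    using x by (intro maximal_monotoneD[OF assms]) (force simp: algebra_simps inner_commute)
  then show ?thesis ..
qed

text \<open>For two solutions the monotone inner product equals minus their squared distance, so the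
  \<open>THE\<close> in \<open>resolvent\<close> is well defined.\<close>

lemma resolvent_residual_mem:
  assumes "maximal_monotone A"
  shows "y - resolvent A y \<in> A (resolvent A y)"
proof -
  obtain x where x: "y - x \<in> A x"
    using minty[OF assms] by blast
  have "x' = x" if "y - x' \<in> A x'" for x'
  proof -
    have "0 \<le> ((y - x') - (y - x)) \<bullet> (x' - x)"
      using assms that x unfolding maximal_monotone_def monotone_operator_def by blast
    also have "\<dots> = - ((x' - x) \<bullet> (x' - x))"
      by (simp add: algebra_simps inner_commute)
    finally have "(x' - x) \<bullet> (x' - x) \<le> 0" by simp
    then show ?thesis
      by (metis inner_eq_zero_iff inner_ge_zero eq_iff_diff_eq_0 order_antisym)
  qed
  moreover have iff: "y \<in> {x + u | u. u \<in> A x} \<longleftrightarrow> y - x \<in> A x" for x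
    by (force simp: algebra_simps)
  ultimately have "resolvent A y = x"
    unfolding resolvent_def iff using x by (intro the_equality)
  then show ?thesis using x by simp
qed

section \<open>The accelerated proximal point method\<close>

text \<open>The first conjunct of the invariant is Halpern's form of the iteration.\<close>
lemma os_ppm0_state_invariant:
  fixes A :: "'n::finite operator"
  assumes "maximal_monotone A" and "os_ppm0_state A z k = (x, y, yp)"
  shows "(real k + 1) *\<^sub>R y = z + real k *\<^sub>R (2 *\<^sub>R x - yp)
    \<and> (k \<ge> 1 \<longrightarrow> yp - x \<in> A x)
    \<and> (real k)\<^sup>2 * ((yp - x) \<bullet> (yp - x)) + real k * ((yp - x) \<bullet> (x - z)) \<le> 0"
  using assms(2)
proof (induction k arbitrary: x y yp)
  case 0
  then show ?case by auto
next
  case (Suc k)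
  obtain x1 y1 yp1 where st: "os_ppm0_state A z k = (x1, y1, yp1)"
    by (cases "os_ppm0_state A z k")
  have IH: "(real k + 1) *\<^sub>R y1 = z + real k *\<^sub>R (2 *\<^sub>R x1 - yp1)" "k \<ge> 1 \<longrightarrow> yp1 - x1 \<in> A x1"
    "(real k)\<^sup>2 * ((yp1 - x1) \<bullet> (yp1 - x1)) + real k * ((yp1 - x1) \<bullet> (x1 - z)) \<le> 0"
    using Suc.IH[OF st] by blast+
  let ?K = "real k"
  \<comment> \<open>At step \<open>Suc k\<close> both correction terms carry the same weight
    \<open>?K / (?K + 2)\<close>.\<close>
  have yp: "yp = y1" and x: "x = resolvent A y1"
    and y: "y = x + (?K / (?K + 2)) *\<^sub>R (x - x1) + (?K / (?K + 2)) *\<^sub>R (yp1 - x1)"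
    using Suc.prems by (auto simp: st Let_def phi_def add_ac)
  have "(?K + 2) *\<^sub>R y = (?K + 2) *\<^sub>R x + ?K *\<^sub>R (x - x1) + ?K *\<^sub>R (yp1 - x1)"
    by (simp add: y scaleR_add_right)
  also have "\<dots> = (2 * ?K + 2) *\<^sub>R x - ((?K + 1) *\<^sub>R y1 - z)"
    unfolding IH(1) by (simp add: vec_eq_iff algebra_simps)
  also have "\<dots> = z + (?K + 1) *\<^sub>R (2 *\<^sub>R x - y1)"
    by (simp add: algebra_simps)
  finally have 1: "(real (Suc k) + 1) *\<^sub>R y = z + real (Suc k) *\<^sub>R (2 *\<^sub>R x - yp)"
    by (simp add: yp algebra_simps)
  have mem: "yp - x \<in> A x"
    unfolding yp x by (rule resolvent_residual_mem[OF assms(1)])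
  define g where "g = yp1 - x1"
  define h where "h = yp - x"
  define w where "w = x1 - z"
  define d where "d = y1 - z"
  \<comment> \<open>Halpern's form relative to \<open>z\<close>; it eliminates
    \<open>h \<bullet> d\<close> and \<open>g \<bullet> d\<close> below.\<close>
  have d: "(?K + 1) *\<^sub>R d = ?K *\<^sub>R (w - g)"
    using IH(1) by (simp add: d_def w_def g_def vec_eq_iff algebra_simps)
  have dh: "(?K + 1) * (h \<bullet> d) = ?K * (h \<bullet> w - h \<bullet> g)" and dg: "(?K + 1) * (g \<bullet> d) = ?K * (g \<bullet> w - g \<bullet> g)"
    using arg_cong[OF d, of "\<lambda>v. h \<bullet> v"] arg_cong[OF d, of "\<lambda>v. g \<bullet> v"]
    by (simp_all add: inner_diff_right)
  have xz: "x - z = d - h" and xx: "x - x1 = d - h - w"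
    by (simp_all add: d_def h_def w_def yp)
  \<comment> \<open>At \<open>k = 0\<close> there is no previous residual; the factor
    \<open>?K\<close> covers that case.\<close>
  have "0 \<le> ?K * ((h - g) \<bullet> (x - x1))"
  proof (cases "k = 0")
    case False
    then have "g \<in> A x1"
      using IH(2) by (simp add: g_def)
    then have "0 \<le> (h - g) \<bullet> (x - x1)"
      using mem assms(1) unfolding h_def maximal_monotone_def monotone_operator_def by blast
    then show ?thesis by simp
  qed simp
  \<comment> \<open>With the weight \<open>?K * (?K + 1)\<close>, monotonicity between consecutive
    iterates is exactly the old potential minus the new one.\<close>
  then have "0 \<le> (?K + 1) * (?K * ((h - g) \<bullet> (x - x1)))"
    by simp
  also have "\<dots> = ?K * ((?K + 1) * (h \<bullet> d)) - ?K * ((?K + 1) * (g \<bullet> d))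
      - ?K * (?K + 1) * (h \<bullet> h - g \<bullet> h + h \<bullet> w - g \<bullet> w)"
    unfolding xx by (simp add: inner_diff algebra_simps)
  also have "\<dots> = (?K\<^sup>2 * (g \<bullet> g) + ?K * (g \<bullet> w))
      - ((?K + 1)\<^sup>2 * (h \<bullet> h) + (?K + 1) * (h \<bullet> d) - (?K + 1) * (h \<bullet> h))"
    unfolding dh dg by (simp add: algebra_simps power2_eq_square inner_commute)
  also have "\<dots> = (?K\<^sup>2 * (g \<bullet> g) + ?K * (g \<bullet> w))
      - ((?K + 1)\<^sup>2 * (h \<bullet> h) + (?K + 1) * (h \<bullet> (x - z)))"
    unfolding xz by (simp add: inner_diff algebra_simps)
  finally have "(real (Suc k))\<^sup>2 * ((yp - x) \<bullet> (yp - x)) + real (Suc k) * ((yp - x) \<bullet> (x - z)) \<le> 0"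
    using IH(3) unfolding g_def[symmetric] h_def[symmetric] w_def[symmetric]
    by (simp add: add.commute)
  then show ?case using 1 mem by blast
qed

lemma os_ppm0_residual_mem:
  assumes "maximal_monotone A" and "t \<ge> 1"
  shows "os_ppm0_residual A z t \<in> A (os_ppm0 A z t)"
  using os_ppm0_state_invariant[OF assms(1), of z t] assms(2)
  by (cases "os_ppm0_state A z t") (simp add: os_ppm0_residual_def os_ppm0_def)

lemma os_ppm0_residual_le:
  assumes max: "maximal_monotone A" and "t \<ge> 1" and zero: "xs \<in> Zer A"
  shows "real t * norm (os_ppm0_residual A z t) \<le> norm (z - xs)"
proof -
  obtain x y yp where st: "os_ppm0_state A z t = (x, y, yp)"
    by (cases "os_ppm0_state A z t")
  define g where "g = yp - x"
  have g: "os_ppm0_residual A z t = g"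
    by (simp add: os_ppm0_residual_def st g_def)
  \<comment> \<open>Monotonicity against the graph point \<open>(xs, 0)\<close> lets
    \<open>xs\<close> replace \<open>x\<close> in the potential bound.\<close>
  have "0 \<le> (g - 0) \<bullet> (x - xs)"
    using os_ppm0_state_invariant[OF max st] \<open>t \<ge> 1\<close> zero max
    unfolding g_def Zer_def maximal_monotone_def monotone_operator_def by blast
  then have mono: "0 \<le> g \<bullet> (x - xs)" by simp
  have "real t * (real t * (g \<bullet> g) + g \<bullet> (x - z)) \<le> 0"
    using os_ppm0_state_invariant[OF max st]
    by (simp add: g_def algebra_simps power2_eq_square)
  then have "real t * (g \<bullet> g) + g \<bullet> (x - z) \<le> 0"
    using \<open>t \<ge> 1\<close> by (simp add: mult_le_0_iff)
  then have "real t * (g \<bullet> g) \<le> g \<bullet> (z - xs)"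
    using mono by (simp add: inner_diff)
  also have "\<dots> \<le> norm g * norm (z - xs)"
    by (rule norm_cauchy_schwarz)
  finally have "norm g * (real t * norm g) \<le> norm g * norm (z - xs)"
    by (simp add: dot_square_norm power2_eq_square algebra_simps)
  then show ?thesis
    unfolding g by (cases "g = 0") simp_all
qed

text \<open>A resolvent step is a run of length 1.\<close>

lemma resolvent_residual_le:
  assumes max: "maximal_monotone A" and zero: "xs \<in> Zer A"
  shows "norm (z - resolvent A z) \<le> norm (z - xs)"
  using os_ppm0_residual_le[OF max _ zero, of 1 z]
  by (simp add: os_ppm0_residual_def Let_def)

text \<open>Cauchy-Schwarz cancels one power of the distance, which leaves a Hoelder error
  bound.\<close>

lemma uniformly_monotone_dist_le:
  assumes "uniformly_monotone \<mu> \<alpha> A" and "\<mu> > 0" and "\<alpha> > 1"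
    and "xs \<in> Zer A" and "u \<in> A x"
  shows "norm (x - xs) \<le> (norm u / \<mu>) powr (1 / \<alpha>)"
proof (cases "x = xs")
  case False
  define d where "d = norm (x - xs)"
  have "d > 0" using False by (simp add: d_def)
  have "\<mu> * d powr (\<alpha> + 1) \<le> u \<bullet> (x - xs)"
    using assms by (auto simp: uniformly_monotone_def d_def)
  also have "\<dots> \<le> norm u * d"
    unfolding d_def by (rule norm_cauchy_schwarz)
  finally have "d powr \<alpha> \<le> norm u / \<mu>"
    using \<open>d > 0\<close> \<open>\<mu> > 0\<close> by (simp add: powr_add field_simps)
  then have "(d powr \<alpha>) powr (1 / \<alpha>) \<le> (norm u / \<mu>) powr (1 / \<alpha>)"
    using \<open>\<alpha> > 1\<close> by (intro powr_mono2) auto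
  then show ?thesis
    using \<open>d > 0\<close> \<open>\<alpha> > 1\<close> by (simp add: powr_powr d_def)
qed simp

section \<open>The restarted method\<close>

locale restart_scheme =
  fixes A :: "'n::finite operator" and \<mu> \<alpha> lam \<beta> :: real and x0 xs :: "real ^ 'n"
  assumes mu_pos: "\<mu> > 0" and alpha_gt1: "\<alpha> > 1"
    and max: "maximal_monotone A"
    and unif: "uniformly_monotone \<mu> \<alpha> A"
    and zero: "xs \<in> Zer A"
    and lam_def: "lam = (exp 1 / \<mu>) powr (1 / \<alpha>) * norm (x0 - xs) powr (- (1 - 1 / \<alpha>))"
    and beta_def: "\<beta> = 1 - 1 / \<alpha>"
    and neq: "x0 \<noteq> xs"
begin

lemma beta_pos: "\<beta> > 0"
  using alpha_gt1 by (simp add: beta_def)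

lemma lam_pos: "lam > 0"
  using mu_pos neq by (simp add: lam_def)

text \<open>The scale \<open>lam\<close> is chosen to make this step contract by exactly \<open>exp (- 1)\<close>.\<close>
lemma os_ppm0_contraction:
  assumes u: "u \<in> A z" and le: "norm u \<le> exp (- real k) * norm (x0 - xs)"
    and t: "real t \<ge> lam * exp (\<beta> * real (Suc k))"
  shows "t \<ge> 1"
    and "norm (os_ppm0_residual A z t) \<le> exp (- real (Suc k)) * norm (x0 - xs)"
proof -
  define D where "D = norm (x0 - xs)"
  have "D > 0" using neq by (simp add: D_def)
  define s where "s = lam * exp (\<beta> * real (Suc k))"
  have "s > 0" using lam_pos by (simp add: s_def)
  then show t1: "t \<ge> 1" using t by (cases t) (auto simp: s_def)
  have "s * norm (os_ppm0_residual A z t) \<le> real t * norm (os_ppm0_residual A z t)"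
    using t by (intro mult_right_mono) (auto simp: s_def)
  also have "\<dots> \<le> norm (z - xs)"
    using max t1 zero by (rule os_ppm0_residual_le)
  also have "\<dots> \<le> (norm u / \<mu>) powr (1 / \<alpha>)"
    using unif mu_pos alpha_gt1 zero u by (rule uniformly_monotone_dist_le)
  also have "\<dots> \<le> (exp (- real k) * D / \<mu>) powr (1 / \<alpha>)"
    using le mu_pos alpha_gt1 by (intro powr_mono2 divide_right_mono) (auto simp: D_def)
  also have "\<dots> = s * (exp (- real (Suc k)) * D)"
  proof -
    \<comment> \<open>The factor \<open>exp 1\<close> in \<open>lam\<close> absorbs the shift from
      \<open>k\<close> to \<open>Suc k\<close>, and its power of \<open>D\<close> leaves the
      exponent \<open>1 / \<alpha>\<close>.\<close>
    have "ln ((exp (- real k) * D / \<mu>) powr (1 / \<alpha>)) = ln (s * (exp (- real (Suc k)) * D))"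
      using \<open>D > 0\<close> mu_pos alpha_gt1 lam_pos
      unfolding s_def lam_def beta_def D_def[symmetric]
      by (simp add: ln_mult ln_div ln_powr field_simps)
    then show ?thesis
      using \<open>D > 0\<close> \<open>s > 0\<close> mu_pos by (subst (asm) ln_inj_iff) auto
  qed
  finally show "norm (os_ppm0_residual A z t) \<le> exp (- real (Suc k)) * norm (x0 - xs)"
    using \<open>s > 0\<close> by (simp add: D_def)
qed

text \<open>The initial resolvent step supplies \<open>u\<close> for the base case; afterwards
  \<open>u\<close> is the last residual of the preceding run.\<close>

lemma restarted_mem:
  assumes "\<And>j. 1 \<le> j \<Longrightarrow> j \<le> k \<Longrightarrow> real (t j) \<ge> lam * exp (\<beta> * real j)"
  shows "\<exists>u \<in> A (restarted A x0 t k). norm u \<le> exp (- real k) * norm (x0 - xs)"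
  using assms
proof (induction k)
  case 0
  then show ?case
    using resolvent_residual_mem[OF max, of x0] resolvent_residual_le[OF max zero, of x0] by auto
next
  case (Suc k)
  then obtain u where u: "u \<in> A (restarted A x0 t k)" "norm u \<le> exp (- real k) * norm (x0 - xs)"
    by fastforce
  have t: "real (t (Suc k)) \<ge> lam * exp (\<beta> * real (Suc k))"
    by (rule Suc.prems) auto
  show ?case
    using os_ppm0_residual_mem[OF max os_ppm0_contraction(1)[OF u t]] os_ppm0_contraction(2)[OF u t]
    by auto
qed

lemma restarted_residual_le:
  assumes "\<And>j. 1 \<le> j \<Longrightarrow> j \<le> R \<Longrightarrow> real (t j) \<ge> lam * exp (\<beta> * real j)" and "R \<ge> 1"
  shows "norm (restarted_residual A x0 t R) \<le> exp (- real R) * norm (x0 - xs)"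
proof -
  obtain k where R: "R = Suc k" using \<open>R \<ge> 1\<close> by (cases R) auto
  obtain u where u: "u \<in> A (restarted A x0 t k)" "norm u \<le> exp (- real k) * norm (x0 - xs)"
    using restarted_mem[of k t] assms(1) R by auto
  show ?thesis
    using os_ppm0_contraction(2)[OF u, of "t R"] assms(1)[of R] by (simp add: restarted_residual_def R)
qed

end

section \<open>Iteration counts and the resulting rate\<close>

lemma restart_length_ge:
  assumes "restart_count lam \<beta> N R" and "1 \<le> k" and "k \<le> R"
  shows "real (restart_length lam \<beta> N R k) \<ge> lam * exp (\<beta> * real k)"
proof -
  let ?c = "\<lambda>k. \<lceil>lam * exp (\<beta> * real k)\<rceil>"
  have "1 \<le> R" and "sum ?c {1..R} \<le> int N - 1"
    using assms(1) by (auto simp: restart_count_def)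
  moreover have "sum ?c {1..R} = sum ?c {1..<R} + ?c R"
    using \<open>1 \<le> R\<close> by (simp add: sum.last_plus atLeastLessThanSuc_atLeastAtMost[symmetric])
  moreover have le_nat: "i \<le> int (nat i)" for i
    by simp
  \<comment> \<open>Only \<open>k = R\<close> needs an argument: the lower bound on
    \<open>N - 1\<close> leaves the last run at least its own ceiling.\<close>
  ultimately have "?c k \<le> (if k < R then ?c k else int N - 1 - sum ?c {1..<R})"
    using \<open>k \<le> R\<close> by (cases "k = R") auto
  then have "?c k \<le> int (restart_length lam \<beta> N R k)"
    unfolding restart_length_def by (rule order_trans[OF _ le_nat])
  then show ?thesis by linarith
qed

lemma sum_exp_geometric:
  fixes \<beta> :: real
  assumes "\<beta> > 0"
  shows "(\<Sum>k=1..n. exp (\<beta> * real k)) = exp \<beta> * (exp (\<beta> * real n) - 1) / (exp \<beta> - 1)"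
proof (induction n)
  case (Suc n)
  have "exp \<beta> \<noteq> 1" using assms by simp
  then show ?case using Suc
    by (simp add: field_simps exp_add)
qed simp

lemma rate_base_le:
  assumes rc: "restart_count lam \<beta> N R" and "lam > 0" and "\<beta> > 0"
  shows "rate_base lam \<beta> N \<le> exp (\<beta> * real R)"
proof -
  define E where "E = exp \<beta>"
  \<comment> \<open>Chosen so that the geometric sum of the unrounded lengths is
    \<open>(exp (\<beta> * real n) - 1) / q\<close>.\<close>
  define q where "q = (E - 1) / (lam * E)"
  have "E > 1" using \<open>\<beta> > 0\<close> by (simp add: E_def)
  then have "q > 0" using \<open>lam > 0\<close> by (simp add: q_def)
  let ?c = "\<lambda>k. \<lceil>lam * exp (\<beta> * real k)\<rceil>"
  have geo: "(\<Sum>k=1..n. lam * exp (\<beta> * real k)) = (exp (\<beta> * real n) - 1) / q" for n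
    using sum_exp_geometric[OF \<open>\<beta> > 0\<close>, of n] \<open>E > 1\<close> \<open>lam > 0\<close>
    by (simp add: sum_distrib_left[symmetric] q_def E_def)
  have "(exp (\<beta> * real R) - 1) / q \<le> (\<Sum>k=1..R. real_of_int (?c k))"
    unfolding geo[symmetric] by (intro sum_mono) linarith
  also have "\<dots> = real_of_int (sum ?c {1..R})" by simp
  also have "\<dots> \<le> real N - 1"
    using rc unfolding restart_count_def by linarith
  finally have "exp (\<beta> * real R) \<le> q * (real N - 1) + 1"
    using \<open>q > 0\<close> by (simp add: field_simps)
  then have "\<beta> * real R \<le> ln (q * (real N - 1) + 1)"
    by (subst ln_ge_iff) (use exp_gt_zero less_le_trans in blast)+
  then have R: "real R \<le> 1 / \<beta> * ln (q * (real N - 1) + 1)"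
    using \<open>\<beta> > 0\<close> by (simp add: field_simps)
  have "real N - 1 \<le> real_of_int (sum ?c {1..R+1})"
    using rc unfolding restart_count_def by linarith
  also have "\<dots> = (\<Sum>k=1..R+1. real_of_int (?c k))" by simp
  \<comment> \<open>Rounding costs at most 1 for each of the \<open>R + 1\<close> runs, whence
    \<open>N - 2 - R\<close> below.\<close>
  also have "\<dots> \<le> (\<Sum>k=1..R+1. lam * exp (\<beta> * real k) + 1)"
    by (intro sum_mono) linarith
  also have "\<dots> = (exp (\<beta> * real (R + 1)) - 1) / q + (real R + 1)"
    unfolding sum.distrib geo by simp
  also have "exp (\<beta> * real (R + 1)) = E * exp (\<beta> * real R)"
    by (simp add: E_def exp_add algebra_simps)
  finally have "q * (real N - 2 - real R) + 1 \<le> E * exp (\<beta> * real R)"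
    using \<open>q > 0\<close> by (simp add: field_simps)
  then have "q / E * (real N - 2 - real R) + 1 / E \<le> exp (\<beta> * real R)"
    using \<open>E > 1\<close> by (simp add: field_simps)
  moreover have "q / E * (real N - 2 - 1 / \<beta> * ln (q * (real N - 1) + 1))
      \<le> q / E * (real N - 2 - real R)"
    using R \<open>q > 0\<close> \<open>E > 1\<close> by (intro mult_left_mono) auto
  moreover have "rate_base lam \<beta> N
      = q / E * (real N - 2 - 1 / \<beta> * ln (q * (real N - 1) + 1)) + 1 / E"
    by (simp add: rate_base_def q_def E_def exp_double power2_eq_square mult.assoc)
  ultimately show ?thesis by linarith
qed

lemma rate_base_asymp:
  assumes "lam > 0" and "\<beta> > 0"
  shows "eventually (\<lambda>N. rate_base lam \<beta> N > 0) at_top"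
    and "(\<lambda>N. rate_base lam \<beta> N powr p) \<in> O(\<lambda>N. real N powr p)"
proof -
  define d where "d = (exp \<beta> - 1) / (lam * exp \<beta>)"
  define c where "c = (exp \<beta> - 1) / (lam * exp (2 * \<beta>))"
  define b where "b = 1 / \<beta>"
  have pos: "d > 0" "c > 0" "b > 0"
    using assms by (simp_all add: c_def d_def b_def)
  have eq: "rate_base lam \<beta> = (\<lambda>N. c * (real N - 2 - b * ln (d * (real N - 1) + 1)) + 1 / exp \<beta>)"
    by (simp add: fun_eq_iff rate_base_def c_def d_def b_def)
  show "eventually (\<lambda>N. rate_base lam \<beta> N > 0) at_top"
    unfolding eq using pos by real_asymp
  show "(\<lambda>N. rate_base lam \<beta> N powr p) \<in> O(\<lambda>N. real N powr p)"
    unfolding eq using pos by real_asymp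
qed

context restart_scheme
begin

lemma restarted_residual_rate:
  assumes rc: "restart_count lam \<beta> N R" and pos: "rate_base lam \<beta> N > 0"
  shows "(norm (restarted_residual A x0 (restart_length lam \<beta> N R) R))\<^sup>2
    \<le> rate_base lam \<beta> N powr (- (2 * \<alpha> / (\<alpha> - 1))) * (norm (x0 - xs))\<^sup>2"
proof -
  have p: "2 * \<alpha> / (\<alpha> - 1) = 2 / \<beta>"
    using alpha_gt1 by (simp add: beta_def field_simps)
  have "norm (restarted_residual A x0 (restart_length lam \<beta> N R) R) \<le> exp (- real R) * norm (x0 - xs)"
    using rc by (intro restarted_residual_le restart_length_ge) (auto simp: restart_count_def)
  then have "(norm (restarted_residual A x0 (restart_length lam \<beta> N R) R))\<^sup>2
      \<le> (exp (- real R))\<^sup>2 * (norm (x0 - xs))\<^sup>2"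
    unfolding power_mult_distrib[symmetric] by (rule power_mono) simp
  \<comment> \<open>Written as a negative power of \<open>exp (\<beta> * real R)\<close>, the bound
    grows when that base is lowered to \<open>rate_base\<close>.\<close>
  also have "(exp (- real R))\<^sup>2 = exp (\<beta> * real R) powr (- (2 / \<beta>))"
    using beta_pos by (simp add: powr_def exp_double[symmetric])
  also have "\<dots> \<le> rate_base lam \<beta> N powr (- (2 / \<beta>))"
    using rate_base_le[OF rc lam_pos beta_pos] pos beta_pos by (intro powr_mono2') auto
  finally show ?thesis
    unfolding p by (simp add: mult_right_mono)
qed

end

(* A negative power of rate_base is a meaningful bound only where rate_base is positive
   (real powr totalises negative bases by their absolute value). rate_base can be nonpositive
   for small N, hence the guard in the first conjunct; it is positive for all large N, so the
   asymptotic claims carry no guard. *)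
theorem theorem5p2:
  fixes A :: "real ^ 'n::finite \<Rightarrow> (real ^ 'n) set"
    and \<mu> \<alpha> lam \<beta> :: real
    and x0 xstar :: "real ^ 'n"
  assumes "\<mu> > 0" and "\<alpha> > 1"
    and "maximal_monotone A"
    and "uniformly_monotone \<mu> \<alpha> A"
    and "xstar \<in> Zer A"
    and "lam = (exp 1 / \<mu>) powr (1 / \<alpha>) * norm (x0 - xstar) powr (- (1 - 1 / \<alpha>))"
    and "\<beta> = 1 - 1 / \<alpha>"
  shows "(\<forall>N R. restart_count lam \<beta> N R \<longrightarrow> rate_base lam \<beta> N > 0 \<longrightarrow>
            (norm (restarted_residual A x0 (restart_length lam \<beta> N R) R))\<^sup>2
              \<le> rate_base lam \<beta> N powr (- (2 * \<alpha> / (\<alpha> - 1))) * (norm (x0 - xstar))\<^sup>2)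
       \<and> (\<lambda>N. rate_base lam \<beta> N powr (- (2 * \<alpha> / (\<alpha> - 1))) * (norm (x0 - xstar))\<^sup>2)
            \<in> O(\<lambda>N. real N powr (- (2 * \<alpha> / (\<alpha> - 1))))
       \<and> (\<forall>R. (\<forall>\<^sub>F N in at_top. restart_count lam \<beta> N (R N)) \<longrightarrow>
            (\<lambda>N. (norm (restarted_residual A x0 (restart_length lam \<beta> N (R N)) (R N)))\<^sup>2)
              \<in> O(\<lambda>N. real N powr (- (2 * \<alpha> / (\<alpha> - 1)))))"
proof (cases "x0 = xstar")
  case True
  \<comment> \<open>As \<open>0 powr r = 0\<close>, all ceilings vanish, and the two conditions on
    \<open>N - 1\<close> contradict each other.\<close>
  then have "lam = 0"
    using assms by simp
  then have no: "\<not> restart_count lam \<beta> N R" for N R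
    by (auto simp: restart_count_def)
  then show ?thesis
    by (simp add: True)
next
  case False
  then interpret restart_scheme A \<mu> \<alpha> lam \<beta> x0 xstar
    by unfold_locales (use assms in auto)
  let ?p = "- (2 * \<alpha> / (\<alpha> - 1))"
  have rate: "(\<lambda>N. rate_base lam \<beta> N powr ?p * (norm (x0 - xstar))\<^sup>2) \<in> O(\<lambda>N. real N powr ?p)"
    using rate_base_asymp(2)[OF lam_pos beta_pos, of ?p] neq by simp
  have "(\<lambda>N. (norm (restarted_residual A x0 (restart_length lam \<beta> N (R N)) (R N)))\<^sup>2)
      \<in> O(\<lambda>N. real N powr ?p)" if "\<forall>\<^sub>F N in at_top. restart_count lam \<beta> N (R N)" for R
  \<comment> \<open>The guarded bound suffices, as \<open>rate_base\<close> is eventually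
    positive.\<close>
  proof (rule landau_o.big_trans[OF landau_o.big_mono rate])
    show "\<forall>\<^sub>F N in at_top.
        norm ((norm (restarted_residual A x0 (restart_length lam \<beta> N (R N)) (R N)))\<^sup>2)
        \<le> norm (rate_base lam \<beta> N powr ?p * (norm (x0 - xstar))\<^sup>2)"
      using that rate_base_asymp(1)[OF lam_pos beta_pos]
      by eventually_elim (use restarted_residual_rate in auto)
  qed
  then show ?thesis
    using restarted_residual_rate rate by blast
qed

end
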